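(* Let $\{Q_p(x)\}_{p\ge 0}$ be a sequence of orthogonal polynomials given by a Favard recurrence $Q_{p+1}(x)=(A_px+B_p)Q_p(x)-C_pQ_{p-1}(x)$, $p\ge 0$, $Q_0(x)=1$, $Q_{-1}(x)=0$, with coefficients as in the context. Let $p,s,t$ be integers with $1\le t\le p$ and $s\ge 1$, and let $\Psi_{p+s}^{(p)},\Psi_{p+s}^{(p-1)},\psi_{p-t}^{(p)},\psi_{p-t}^{(p-1)}$ be the coefficient functions defined in the context. Then for every real $x$ with $\Psi_{p+s}^{(p-1)}(x)\neq 0$ and $\psi_{p-t}^{(p-1)}(x)\ne 0$, $$Q_{p+s}(x)=M(x)Q_p(x)+N(x)Q_{p-t}(x),$$ where $$M(x)=\frac{\det(\mathbf K)}{\psi_{p-t}^{(p-1)}(x)},\qquad N(x)=\frac{\Psi_{p+s}^{(p-1)}(x)}{\psi_{p-t}^{(p-1)}(x)},\qquad \mathbf K=\begin{bmatrix}\Psi_{p+s}^{(p)}(x)&\Psi_{p+s}^{(p-1)}(x)\\ \psi_{p-t}^{(p)}(x)&\psi_{p-t}^{(p-1)}(x)\end{bmatrix}.$$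
   Context: Favard coefficients: $(A_p)_{p\ge0},(B_p)_{p\ge0},(C_p)_{p\ge 0}$ are real sequences with $A_p\ne0$ for all $p\ge 0$, and $C_p\neq 0$ and $C_pA_pA_{p-1}>0$ for all $p\ge 1$ ($C_0$ is irrelevant since $Q_{-1}=0$). Notation: for $i\ge 1$, $S_i(x)=A_ix+B_i$, $T_i(x)=S_i(x)/C_i$, $D_i=1/C_i$. Degree-increase coefficients: for fixed $p\ge1$, the functions $\Psi_{p+s}^{(p)},\Psi_{p+s}^{(p-1)}$ ($s\ge1$) are defined by $\Psi_{p+1}^{(p)}(x)=S_p(x)$, $\Psi_{p+1}^{(p-1)}(x)=-C_p$; $\Psi_{p+2}^{(p)}(x)=S_{p+1}(x)S_p(x)-C_{p+1}$, $\Psi_{p+2}^{(p-1)}(x)=-C_pS_{p+1}(x)$; and for $s\ge3$ and each $j\in\{p,p-1\}$, $\Psi_{p+s}^{(j)}(x)=S_{p+s-1}(x)\Psi_{p+s-1}^{(j)}(x)-C_{p+s-1}\Psi_{p+s-2}^{(j)}(x)$. Degree-decrease coefficients: for fixed $p\ge1$, the functions $\psi_{p-t}^{(p)},\psi_{p-t}^{(p-1)}$ ($1\le t\le p$) are defined by $\psi_{p-1}^{(p)}(x)=0$, $\psi_{p-1}^{(p-1)}(x)=1$; $\psi_{p-2}^{(p)}(x)=-D_{p-1}$, $\psi_{p-2}^{(p-1)}(x)=T_{p-1}(x)$; and for $t\ge3$ and each $j\in\{p,p-1\}$, $\psi_{p-t}^{(j)}(x)=T_{p-t+1}(x)\psi_{p-t+1}^{(j)}(x)-D_{p-t+1}\psi_{p-t+2}^{(j)}(x)$.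 *)

theory Defs
  imports "HOL-Analysis.Determinants" "HOL-Computational_Algebra.Polynomial"
begin

text \<open>\<open>C 0\<close> is unconstrained: it only ever multiplies \<open>Q\<^sub>-\<^sub>1 = 0\<close>.\<close>

definition favard_coeffs :: "(nat \<Rightarrow> real) \<Rightarrow> (nat \<Rightarrow> real) \<Rightarrow> bool" where
  "favard_coeffs A C \<longleftrightarrow>
     (\<forall>p. A p \<noteq> 0) \<and> (\<forall>p\<ge>1. C p \<noteq> 0 \<and> C p * A p * A (p - 1) > 0)"

text \<open>The \<open>case\<close> expression is \<open>Q\<^sub>p\<^sub>-\<^sub>1\<close> with the convention \<open>Q\<^sub>-\<^sub>1 = 0\<close>.
  Orthogonality with respect to a positive definite functional is not assumed
  separately: by Favard's theorem it follows from the recurrence and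
  \<^const>\<open>favard_coeffs\<close>.\<close>

definition favard_polys ::
  "(nat \<Rightarrow> real) \<Rightarrow> (nat \<Rightarrow> real) \<Rightarrow> (nat \<Rightarrow> real) \<Rightarrow> (nat \<Rightarrow> real poly) \<Rightarrow> bool" where
  "favard_polys A B C Q \<longleftrightarrow>
     Q 0 = 1 \<and>
     (\<forall>p. Q (Suc p) = [:B p, A p:] * Q p
                       - smult (C p) (case p of 0 \<Rightarrow> 0 | Suc k \<Rightarrow> Q k))"

definition favard_S :: "(nat \<Rightarrow> real) \<Rightarrow> (nat \<Rightarrow> real) \<Rightarrow> nat \<Rightarrow> real \<Rightarrow> real" where
  "favard_S A B i x = A i * x + B i"

definition favard_T ::
  "(nat \<Rightarrow> real) \<Rightarrow> (nat \<Rightarrow> real) \<Rightarrow> (nat \<Rightarrow> real) \<Rightarrow> nat \<Rightarrow> real \<Rightarrow> real" where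
  "favard_T A B C i x = favard_S A B i x / C i"

definition favard_D :: "(nat \<Rightarrow> real) \<Rightarrow> nat \<Rightarrow> real" where
  "favard_D C i = 1 / C i"

text \<open>Degree increase: \<open>Psi_p A B C p s\<close> and \<open>Psi_pm1 A B C p s\<close> are
  \<open>\<Psi>\<close> with lower index \<open>p + s\<close> and upper index \<open>p\<close>, respectively \<open>p - 1\<close>.
  They are meaningful for \<open>p \<ge> 1\<close> and \<open>s \<ge> 1\<close> only.\<close>

fun Psi_p ::
  "(nat \<Rightarrow> real) \<Rightarrow> (nat \<Rightarrow> real) \<Rightarrow> (nat \<Rightarrow> real) \<Rightarrow> nat \<Rightarrow> nat \<Rightarrow> real \<Rightarrow> real" where
  "Psi_p A B C p 0 x = undefined"
| "Psi_p A B C p (Suc 0) x = favard_S A B p x"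
| "Psi_p A B C p (Suc (Suc 0)) x = favard_S A B (p + 1) x * favard_S A B p x - C (p + 1)"
| "Psi_p A B C p (Suc (Suc (Suc s))) x =
     favard_S A B (p + s + 2) x * Psi_p A B C p (Suc (Suc s)) x
       - C (p + s + 2) * Psi_p A B C p (Suc s) x"

fun Psi_pm1 ::
  "(nat \<Rightarrow> real) \<Rightarrow> (nat \<Rightarrow> real) \<Rightarrow> (nat \<Rightarrow> real) \<Rightarrow> nat \<Rightarrow> nat \<Rightarrow> real \<Rightarrow> real" where
  "Psi_pm1 A B C p 0 x = undefined"
| "Psi_pm1 A B C p (Suc 0) x = - C p"
| "Psi_pm1 A B C p (Suc (Suc 0)) x = - C p * favard_S A B (p + 1) x"
| "Psi_pm1 A B C p (Suc (Suc (Suc s))) x =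
     favard_S A B (p + s + 2) x * Psi_pm1 A B C p (Suc (Suc s)) x
       - C (p + s + 2) * Psi_pm1 A B C p (Suc s) x"

text \<open>Degree decrease: \<open>psi_p A B C p t\<close> and \<open>psi_pm1 A B C p t\<close> are
  \<open>\<psi>\<close> with lower index \<open>p - t\<close> and upper index \<open>p\<close>, respectively \<open>p - 1\<close>.
  They are meaningful for \<open>1 \<le> t \<le> p\<close> only, where no subtraction on naturals
  truncates.\<close>

fun psi_p ::
  "(nat \<Rightarrow> real) \<Rightarrow> (nat \<Rightarrow> real) \<Rightarrow> (nat \<Rightarrow> real) \<Rightarrow> nat \<Rightarrow> nat \<Rightarrow> real \<Rightarrow> real" where
  "psi_p A B C p 0 x = undefined"
| "psi_p A B C p (Suc 0) x = 0"
| "psi_p A B C p (Suc (Suc 0)) x = - favard_D C (p - 1)"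
| "psi_p A B C p (Suc (Suc (Suc t))) x =
     favard_T A B C (p - (t + 3) + 1) x * psi_p A B C p (Suc (Suc t)) x
       - favard_D C (p - (t + 3) + 1) * psi_p A B C p (Suc t) x"

fun psi_pm1 ::
  "(nat \<Rightarrow> real) \<Rightarrow> (nat \<Rightarrow> real) \<Rightarrow> (nat \<Rightarrow> real) \<Rightarrow> nat \<Rightarrow> nat \<Rightarrow> real \<Rightarrow> real" where
  "psi_pm1 A B C p 0 x = undefined"
| "psi_pm1 A B C p (Suc 0) x = 1"
| "psi_pm1 A B C p (Suc (Suc 0)) x = favard_T A B C (p - 1) x"
| "psi_pm1 A B C p (Suc (Suc (Suc t))) x =
     favard_T A B C (p - (t + 3) + 1) x * psi_pm1 A B C p (Suc (Suc t)) x
       - favard_D C (p - (t + 3) + 1) * psi_pm1 A B C p (Suc t) x"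

end

theory Submission
  imports Defs
begin

text \<open>
  The Favard recurrence is of second order, so at a fixed point \<open>x\<close> the two consecutive values
  \<open>Q\<^sub>p\<close> and \<open>Q\<^sub>p\<^sub>-\<^sub>1\<close> determine all others linearly. Run upwards, it gives
  \<open>Q\<^sub>p\<^sub>+\<^sub>s = \<Psi>\<^sup>p Q\<^sub>p + \<Psi>\<^sup>p\<^sup>-\<^sup>1 Q\<^sub>p\<^sub>-\<^sub>1\<close> (lemma \<open>degree_increase\<close>); run downwards, which is possible because
  \<open>C\<^sub>i \<noteq> 0\<close> for \<open>i \<ge> 1\<close>, it gives \<open>Q\<^sub>p\<^sub>-\<^sub>t = \<psi>\<^sup>p Q\<^sub>p + \<psi>\<^sup>p\<^sup>-\<^sup>1 Q\<^sub>p\<^sub>-\<^sub>1\<close> (lemma \<open>degree_decrease\<close>).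
  Eliminating \<open>Q\<^sub>p\<^sub>-\<^sub>1\<close> between these two equations is a division by \<open>\<psi>\<^sup>p\<^sup>-\<^sup>1\<close>, and the remaining
  coefficient of \<open>Q\<^sub>p\<close> is the determinant of the \<open>2 \<times> 2\<close> system divided by \<open>\<psi>\<^sup>p\<^sup>-\<^sup>1\<close>.
\<close>

lemma favard_poly_Suc_Suc:
  assumes "favard_polys A B C Q"
  shows "poly (Q (Suc (Suc n))) x =
           favard_S A B (Suc n) x * poly (Q (Suc n)) x - C (Suc n) * poly (Q n) x"
proof -
  have "Q (Suc (Suc n)) = [:B (Suc n), A (Suc n):] * Q (Suc n) - smult (C (Suc n)) (Q n)"
    using assms unfolding favard_polys_def by (metis nat.case(2))
  then show ?thesis
    by (simp only: poly_diff poly_mult poly_smult) (simp add: favard_S_def algebra_simps)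
qed

lemma favard_poly_backward:
  assumes "favard_polys A B C Q" and "C (Suc n) \<noteq> 0"
  shows "poly (Q n) x =
           favard_T A B C (Suc n) x * poly (Q (Suc n)) x
             - favard_D C (Suc n) * poly (Q (Suc (Suc n))) x"
  using assms(2)
  by (simp add: favard_poly_Suc_Suc[OF assms(1)] favard_T_def favard_D_def field_simps)

lemma degree_increase:
  assumes Q: "favard_polys A B C Q" and "1 \<le> p" and "1 \<le> s"
  shows "poly (Q (p + s)) x =
           Psi_p A B C p s x * poly (Q p) x + Psi_pm1 A B C p s x * poly (Q (p - 1)) x"
proof -
  obtain k where p: "p = Suc k"
    using \<open>1 \<le> p\<close> by (cases p) auto
  note step = favard_poly_Suc_Suc[OF Q]
  have "poly (Q (p + Suc m)) x =
          Psi_p A B C p (Suc m) x * poly (Q p) x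
            + Psi_pm1 A B C p (Suc m) x * poly (Q (p - 1)) x" for m
  proof (induction m rule: induct_nat_012)
    case 0
    then show ?case
      by (simp add: p step)
  next
    case 1
    then show ?case
      by (simp add: p step algebra_simps)
  next
    case (ge2 m)
    have "poly (Q (p + Suc (Suc (Suc m)))) x =
            favard_S A B (p + m + 2) x * poly (Q (p + Suc (Suc m))) x
              - C (p + m + 2) * poly (Q (p + Suc m)) x"
      using step[of "p + Suc m"] by simp
    then show ?case
      unfolding ge2.IH by (simp add: algebra_simps)
  qed
  from this[of "s - 1"] \<open>1 \<le> s\<close> show ?thesis
    by simp
qed

text \<open>Solving the recurrence for its lowest term, down to \<open>Q\<^sub>p\<^sub>-\<^sub>t\<close>, divides by the \<open>C\<^sub>i\<close> with
  \<open>p - t < i < p\<close>; by \<open>t \<le> p\<close> these indices are all at least \<open>1\<close>.\<close>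

lemma degree_decrease:
  assumes Q: "favard_polys A B C Q" and C: "\<And>i. 1 \<le> i \<Longrightarrow> C i \<noteq> 0"
    and "1 \<le> t" and "t \<le> p"
  shows "poly (Q (p - t)) x =
           psi_p A B C p t x * poly (Q p) x + psi_pm1 A B C p t x * poly (Q (p - 1)) x"
proof -
  have backward: "poly (Q n) x =
      favard_T A B C (Suc n) x * poly (Q (Suc n)) x
        - favard_D C (Suc n) * poly (Q (Suc (Suc n))) x" for n
    by (rule favard_poly_backward[OF Q C]) simp
  have "poly (Q (p - Suc m)) x =
          psi_p A B C p (Suc m) x * poly (Q p) x
            + psi_pm1 A B C p (Suc m) x * poly (Q (p - 1)) x" if "Suc m \<le> p" for m
    using that
  proof (induction m rule: induct_nat_012)
    case 0
    then show ?case
      by simp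
  next
    case 1
    then have "Suc (p - 2) = p - 1" "Suc (p - 1) = p"
      by simp_all
    with backward[of "p - 2"] show ?case
      by (simp add: numeral_2_eq_2)
  next
    case (ge2 m)
    have idx: "p - Suc (Suc m) = Suc (p - (m + 3))" "p - Suc m = Suc (Suc (p - (m + 3)))"
      using ge2.prems by simp_all
    have "poly (Q (p - Suc (Suc (Suc m)))) x =
            favard_T A B C (p - (m + 3) + 1) x * poly (Q (p - Suc (Suc m))) x
              - favard_D C (p - (m + 3) + 1) * poly (Q (p - Suc m)) x"
      using backward[of "p - (m + 3)"] by (simp add: idx numeral_3_eq_3)
    moreover have "Suc m \<le> p" "Suc (Suc m) \<le> p"
      using ge2.prems by simp_all
    ultimately show ?case
      using ge2.IH by (simp add: algebra_simps)
  qed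
  from this[of "t - 1"] \<open>1 \<le> t\<close> \<open>t \<le> p\<close> show ?thesis
    by simp
qed

theorem theorem4:
  fixes A B C :: "nat \<Rightarrow> real"
    and Q :: "nat \<Rightarrow> real poly"
    and p s t :: nat
    and x :: real
  assumes "favard_coeffs A C"
    and "favard_polys A B C Q"
    and "1 \<le> t" and "t \<le> p" and "1 \<le> s"
    and "Psi_pm1 A B C p s x \<noteq> 0"
    and "psi_pm1 A B C p t x \<noteq> 0"
  shows "let K = (vector [vector [Psi_p A B C p s x, Psi_pm1 A B C p s x],
                          vector [psi_p A B C p t x, psi_pm1 A B C p t x]] :: real^2^2);
             M = det K / psi_pm1 A B C p t x;
             N = Psi_pm1 A B C p s x / psi_pm1 A B C p t x
         in poly (Q (p + s)) x = M * poly (Q p) x + N * poly (Q (p - t)) x"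
proof -
  have C: "C i \<noteq> 0" if "1 \<le> i" for i
    using assms(1) that by (simp add: favard_coeffs_def)
  have up: "poly (Q (p + s)) x =
      Psi_p A B C p s x * poly (Q p) x + Psi_pm1 A B C p s x * poly (Q (p - 1)) x"
    using degree_increase[OF assms(2)] assms(3-5) by simp
  have down: "poly (Q (p - t)) x =
      psi_p A B C p t x * poly (Q p) x + psi_pm1 A B C p t x * poly (Q (p - 1)) x"
    by (rule degree_decrease[OF assms(2) C assms(3,4)])
  show ?thesis
    unfolding Let_def up down det_2 using assms(7)
    by (simp add: field_simps)
qed

end
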